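(* In the abstract setting of the context let $u\in X$ be a regular solution to $N(u)=0$ with inf-sup constant $\beta>0$. Let $v_h\in X_h$ satisfy $\|u-Qv_h\|_X<\beta/\|\Gamma\|$ and suppose that $$\|u-v_h\|_{\widehat X}\le\epsilon\le\frac{\kappa\beta}{\|\Gamma\|(1+\Lambda_4)}$$ for some positive $\kappa<1$ and some $\epsilon$. Set $L:=\|\widehat a\|+2\|\widehat\Gamma\|\big(\|u\|_X+\epsilon(1+\Lambda_4)\big)$, $C_{rel,1}:=1/(\beta(1-\kappa))$, $C_{rel,2}:=1+L\,C_{rel,1}$, and $C_{eff,1}:=(1+\Lambda_4)(\|DN(u)\|+\beta)+L\Lambda_4$. Then reliability holds in the sense that $$\|u-v_h\|_{\widehat X}\le C_{rel,1}\|\widehat N(v_h)\|_{Y^*}+C_{rel,2}\|Qv_h-v_h\|_{\widehat X},$$ and efficiency holds in the sense that $$\|Qv_h-v_h\|_{\widehat X}\le\Lambda_4\|u-v_h\|_{\widehat X}\qquad\text{and}\qquad\|\widehat N(v_h)\|_{Y^*}\le C_{eff,1}\|u-v_h\|_{\widehat X}.$$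
   Context: $\widehat X,\widehat Y$ are real Banach spaces; $X,X_h\subset\widehat X$ and $Y\subset\widehat Y$ are complete linear subspaces with inherited norms. $\widehat a:\widehat X\times\widehat Y\to\mathbb R$ is a bounded bilinear form with bound $\|\widehat a\|$, $\widehat\Gamma:\widehat X\times\widehat X\times\widehat Y\to\mathbb R$ is a bounded trilinear form with bound $\|\widehat\Gamma\|>0$, $\widehat F\in\widehat Y^*$, and $\widehat N(\widehat x):=\widehat a(\widehat x,\bullet)-\widehat F+\widehat\Gamma(\widehat x,\widehat x,\bullet)\in\widehat Y^*$; $\|\widehat N(v_h)\|_{Y^*}$ is the dual norm of the restriction of $\widehat N(v_h)$ to $Y$. With $\Gamma:=\widehat\Gamma|_{X\times X\times Y}$ (bound $\|\Gamma\|$, nonzero), $N:X\to Y^*$ is $N(x):=\widehat N(x)|_Y$. A regular solution is $u\in X$ with $N(u)=0$ such that $DN(u)\in L(X;Y^* )$, $DN(u;x,y)=\widehat a(x,y)+\Gamma(u,x,y)+\Gamma(x,u,y)$, is invertible; then $0<\beta:=\inf_{x\in X,\|x\|_X=1}\sup_{y\in Y,\|y\|_Y=1}DN(u;x,y)$, and $\|DN(u)\|$ is the norm in $L(X;Y^* )$. The operator $Q\in L(X_h;X)$ and $0\le\Lambda_4<\infty$ satisfy $\|(1-Q)x_h\|_{\widehat X}\le\Lambda_4\,\mathrm{dist}_{\|\bullet\|_{\widehat X}}(x_h,X)$ for all $x_h\in X_h$. *)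

theory Defs
  imports "HOL-Analysis.Analysis"
begin

text \<open>Maps between subspaces are represented by functions on the ambient types; only their values
  on the given sets are constrained.\<close>

definition bounded_linear_on ::
  "'a::real_normed_vector set \<Rightarrow> ('a \<Rightarrow> 'b::real_normed_vector) \<Rightarrow> bool" where
  "bounded_linear_on S f \<longleftrightarrow>
     (\<forall>x\<in>S. \<forall>y\<in>S. f (x + y) = f x + f y) \<and>
     (\<forall>c. \<forall>x\<in>S. f (c *\<^sub>R x) = c *\<^sub>R f x) \<and>
     (\<exists>K. \<forall>x\<in>S. norm (f x) \<le> K * norm x)"

definition bounded_trilinear_form ::
  "('a::real_normed_vector \<Rightarrow> 'b::real_normed_vector \<Rightarrow> 'c::real_normed_vector \<Rightarrow> real) \<Rightarrow> bool" where
  "bounded_trilinear_form T \<longleftrightarrow>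
     (\<forall>y z. linear (\<lambda>x. T x y z)) \<and>
     (\<forall>x z. linear (\<lambda>y. T x y z)) \<and>
     (\<forall>x y. linear (\<lambda>z. T x y z)) \<and>
     (\<exists>K. \<forall>x y z. \<bar>T x y z\<bar> \<le> K * norm x * norm y * norm z)"

text \<open>Extensionality makes elements of the dual equal exactly when they agree on \<open>Y\<close>.\<close>

definition dual_space :: "'b::real_normed_vector set \<Rightarrow> ('b \<Rightarrow> real) set" where
  "dual_space Y = {f \<in> extensional Y. bounded_linear_on Y f}"

text \<open>The norms are suprema over closed unit balls rather than unit spheres, so that they are
  also correct (namely 0) on the zero space.\<close>

definition dual_norm :: "'b::real_normed_vector set \<Rightarrow> ('b \<Rightarrow> real) \<Rightarrow> real" where
  "dual_norm Y f = (SUP y\<in>{y\<in>Y. norm y \<le> 1}. \<bar>f y\<bar>)"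

text \<open>This is also the norm in \<open>L(X;Y\<^sup>*)\<close> of \<open>x \<mapsto> B x\<close>.\<close>

definition bilinear_norm ::
  "'a::real_normed_vector set \<Rightarrow> 'b::real_normed_vector set \<Rightarrow> ('a \<Rightarrow> 'b \<Rightarrow> real) \<Rightarrow> real" where
  "bilinear_norm X Y B = (SUP x\<in>{x\<in>X. norm x \<le> 1}. dual_norm Y (B x))"

definition trilinear_norm ::
  "'a::real_normed_vector set \<Rightarrow> 'b::real_normed_vector set \<Rightarrow> 'c::real_normed_vector set
     \<Rightarrow> ('a \<Rightarrow> 'b \<Rightarrow> 'c \<Rightarrow> real) \<Rightarrow> real" where
  "trilinear_norm X Y Z T = (SUP x\<in>{x\<in>X. norm x \<le> 1}. bilinear_norm Y Z (T x))"

definition inf_sup_const ::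
  "'a::real_normed_vector set \<Rightarrow> 'b::real_normed_vector set \<Rightarrow> ('a \<Rightarrow> 'b \<Rightarrow> real) \<Rightarrow> real" where
  "inf_sup_const X Y B = (INF x\<in>{x\<in>X. norm x = 1}. SUP y\<in>{y\<in>Y. norm y = 1}. B x y)"

text \<open>Invertibility in \<open>L(X;Y\<^sup>*)\<close> of the operator \<open>x \<mapsto> B x\<close> induced by a bounded bilinear form:
  it is a bijection onto the dual, and the second conjunct says that its (automatically linear)
  inverse is bounded.\<close>

definition invertible_into_dual ::
  "'a::real_normed_vector set \<Rightarrow> 'b::real_normed_vector set \<Rightarrow> ('a \<Rightarrow> 'b \<Rightarrow> real) \<Rightarrow> bool" where
  "invertible_into_dual X Y B \<longleftrightarrow>
     bij_betw (\<lambda>x. restrict (B x) Y) X (dual_space Y) \<and>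
     (\<exists>C. \<forall>x\<in>X. norm x \<le> C * dual_norm Y (B x))"

text \<open>\<open>a\<close>, \<open>G\<close>, \<open>F\<close> are the forms on the ambient spaces; restrictions to \<open>X\<close> and \<open>Y\<close> enter through
  the sets in the norms and quantifiers. In particular \<open>N(x)\<close> is \<open>Nhat a G F x\<close> evaluated on \<open>Y\<close>.\<close>

definition Nhat ::
  "('a \<Rightarrow> 'b \<Rightarrow> real) \<Rightarrow> ('a \<Rightarrow> 'a \<Rightarrow> 'b \<Rightarrow> real) \<Rightarrow> ('b \<Rightarrow> real) \<Rightarrow> 'a \<Rightarrow> 'b \<Rightarrow> real" where
  "Nhat a G F x = (\<lambda>y. a x y - F y + G x x y)"

definition DN ::
  "('a \<Rightarrow> 'b \<Rightarrow> real) \<Rightarrow> ('a \<Rightarrow> 'a \<Rightarrow> 'b \<Rightarrow> real) \<Rightarrow> 'a \<Rightarrow> 'a \<Rightarrow> 'b \<Rightarrow> real" where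
  "DN a G u x y = a x y + G u x y + G x u y"

definition regular_solution ::
  "'a::real_normed_vector set \<Rightarrow> 'b::real_normed_vector set \<Rightarrow> ('a \<Rightarrow> 'b \<Rightarrow> real)
     \<Rightarrow> ('a \<Rightarrow> 'a \<Rightarrow> 'b \<Rightarrow> real) \<Rightarrow> ('b \<Rightarrow> real) \<Rightarrow> 'a \<Rightarrow> bool" where
  "regular_solution X Y a G F u \<longleftrightarrow>
     u \<in> X \<and> (\<forall>y\<in>Y. Nhat a G F u y = 0) \<and> invertible_into_dual X Y (DN a G u)"

end

theory Submission imports Defs begin

text \<open>Write \<open>e = u - Q v\<^sub>h\<close>. The quadratic structure of \<open>N\<close> gives
  \<open>N (Q v\<^sub>h) = \<Gamma> e e - DN u e\<close> on \<open>Y\<close>, so the inf-sup condition and \<open>\<gamma> \<parallel>e\<parallel> \<le> \<kappa> \<beta>\<close> absorb the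
  quadratic term and bound \<open>\<parallel>e\<parallel>\<close> by \<open>\<parallel>N (Q v\<^sub>h)\<parallel>\<close>, while boundedness bounds \<open>\<parallel>N (Q v\<^sub>h)\<parallel>\<close> by \<open>\<parallel>e\<parallel>\<close>.
  Replacing \<open>N (Q v\<^sub>h)\<close> by \<open>N v\<^sub>h\<close> costs at most \<open>L \<parallel>Q v\<^sub>h - v\<^sub>h\<parallel>\<close>.\<close>

section \<open>Suprema over unit balls\<close>

text \<open>Write \<open>x\<close> as \<open>norm x\<close> times its normalisation, which lies in
  the ball. Homogeneity is asked for only as an inequality, the form in which nested norms deliver
  it; \<open>bnd\<close> makes the real supremum a genuine least upper bound.\<close>

lemma sublinear_le_SUP_unit_ball:
  fixes g :: "'a::real_normed_vector \<Rightarrow> real"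
  assumes "subspace X" "x \<in> X"
    and hom: "\<And>c x. x \<in> X \<Longrightarrow> g (c *\<^sub>R x) \<le> \<bar>c\<bar> * g x"
    and bnd: "\<And>x. x \<in> X \<Longrightarrow> g x \<le> K * norm x"
  shows "g x \<le> (SUP x\<in>{x\<in>X. norm x \<le> 1}. g x) * norm x"
proof (cases "x = 0")
  case True
  then show ?thesis using bnd[OF \<open>x \<in> X\<close>] by simp
next
  case False
  let ?s = "x /\<^sub>R norm x"
  have s: "?s \<in> {x\<in>X. norm x \<le> 1}"
    using assms(1,2) False by (simp add: subspace_scale)
  \<comment> \<open>The sign of \<open>K\<close> is unknown, so the bound on the ball is
    \<open>max K 0\<close>.\<close>
  have "g x' \<le> max K 0" if "x' \<in> {x\<in>X. norm x \<le> 1}" for x'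
  proof -
    have "K * norm x' \<le> max K 0 * 1"
      using that by (intro mult_mono) auto
    then show ?thesis using bnd[of x'] that by auto
  qed
  then have "bdd_above (g ` {x\<in>X. norm x \<le> 1})"
    by (auto intro!: bdd_aboveI2)
  then have "g ?s \<le> (SUP x\<in>{x\<in>X. norm x \<le> 1}. g x)"
    using s by (rule cSUP_upper2) simp
  moreover have "g x \<le> norm x * g ?s"
    using hom[of ?s "norm x"] s False by simp
  ultimately show ?thesis
    using mult_left_mono[of "g ?s" _ "norm x"] by (metis mult.commute norm_ge_zero order_trans)
qed

lemma SUP_unit_ball_le:
  fixes g :: "'a::real_normed_vector \<Rightarrow> real"
  assumes "subspace X" "\<And>x. x \<in> X \<Longrightarrow> g x \<le> K * norm x" "K \<ge> 0"
  shows "(SUP x\<in>{x\<in>X. norm x \<le> 1}. g x) \<le> K"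
proof (rule cSUP_least)
  show "{x\<in>X. norm x \<le> 1} \<noteq> {}"
    using subspace_0[OF assms(1)] by (auto intro!: exI[of _ 0])
  show "g x \<le> K" if "x \<in> {x\<in>X. norm x \<le> 1}" for x
    using assms(2)[of x] mult_left_le[of "norm x" K] assms(3) that by auto
qed

section \<open>Norms of functionals and bilinear forms\<close>

lemma dual_norm_least:
  assumes "subspace Y" "\<And>y. y \<in> Y \<Longrightarrow> \<bar>f y\<bar> \<le> K * norm y" "K \<ge> 0"
  shows "dual_norm Y f \<le> K"
  unfolding dual_norm_def using assms by (intro SUP_unit_ball_le) auto

lemma abs_le_dual_norm:
  assumes "subspace Y" "bounded_linear f" "y \<in> Y"
  shows "\<bar>f y\<bar> \<le> dual_norm Y f * norm y"
proof -
  interpret bounded_linear f by fact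
  obtain K where "\<And>x. norm (f x) \<le> norm x * K" using bounded by blast
  then show ?thesis
    unfolding dual_norm_def using assms
    by (intro sublinear_le_SUP_unit_ball[where g="\<lambda>y. \<bar>f y\<bar>" and K=K])
       (auto simp: scale abs_mult mult.commute)
qed

text \<open>The bounded supremum dominates the value at 0, which also covers the zero space.\<close>

lemma dual_norm_nonneg:
  assumes "subspace Y" "bounded_linear f"
  shows "0 \<le> dual_norm Y f"
proof -
  interpret bounded_linear f by fact
  obtain K where K: "\<And>x. norm (f x) \<le> norm x * K" "0 < K" using pos_bounded by blast
  have "\<bar>f x\<bar> \<le> K" if "norm x \<le> 1" for x
    using K(1)[of x] mult_right_mono[of "norm x" 1 K] K(2) that
    unfolding real_norm_def by linarith
  then have "bdd_above ((\<lambda>y. \<bar>f y\<bar>) ` {y\<in>Y. norm y \<le> 1})"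
    by (auto intro!: bdd_aboveI2)
  then have "\<bar>f 0\<bar> \<le> dual_norm Y f"
    unfolding dual_norm_def using subspace_0[OF assms(1)] by (intro cSUP_upper) auto
  then show ?thesis by simp
qed

text \<open>The map sending \<open>x\<close> to \<open>dual_norm Y (B x)\<close> satisfies the
  hypotheses of \<open>sublinear_le_SUP_unit_ball\<close>; both its homogeneity and its bound follow
  from \<open>dual_norm_least\<close>.\<close>

lemma dual_norm_le_bilinear_norm:
  assumes "subspace X" "subspace Y" "bounded_bilinear B" "x \<in> X"
  shows "dual_norm Y (B x) \<le> bilinear_norm X Y B * norm x"
proof -
  interpret bounded_bilinear B by fact
  obtain K where K: "0 \<le> K" "\<And>x y. norm (B x y) \<le> norm x * norm y * K"
    using nonneg_bounded by blast
  have lin: "bounded_linear (B x)" for x by (rule bounded_linear_right)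
  have "dual_norm Y (B (c *\<^sub>R x)) \<le> \<bar>c\<bar> * dual_norm Y (B x)" for c x
  proof (rule dual_norm_least)
    show "\<bar>B (c *\<^sub>R x) y\<bar> \<le> \<bar>c\<bar> * dual_norm Y (B x) * norm y" if "y \<in> Y" for y
      using abs_le_dual_norm[OF assms(2) lin[of x] that]
      by (simp add: scaleR_left abs_mult mult_left_mono mult.assoc)
  qed (use assms lin in \<open>auto intro!: mult_nonneg_nonneg dual_norm_nonneg\<close>)
  moreover have "dual_norm Y (B x) \<le> K * norm x" for x
    using K assms(2) by (intro dual_norm_least) (auto simp: mult_ac)
  ultimately show ?thesis
    unfolding bilinear_norm_def using assms by (intro sublinear_le_SUP_unit_ball[where K=K]) auto
qed

lemma abs_le_bilinear_norm:
  assumes "subspace X" "subspace Y" "bounded_bilinear B" "x \<in> X" "y \<in> Y"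
  shows "\<bar>B x y\<bar> \<le> bilinear_norm X Y B * norm x * norm y"
proof -
  have "\<bar>B x y\<bar> \<le> dual_norm Y (B x) * norm y"
    using assms by (intro abs_le_dual_norm bounded_bilinear.bounded_linear_right)
  also have "\<dots> \<le> bilinear_norm X Y B * norm x * norm y"
    using assms by (intro mult_right_mono dual_norm_le_bilinear_norm) auto
  finally show ?thesis .
qed

lemma bilinear_norm_least:
  assumes "subspace X" "subspace Y" "K \<ge> 0"
    and "\<And>x y. x \<in> X \<Longrightarrow> y \<in> Y \<Longrightarrow> \<bar>B x y\<bar> \<le> K * norm x * norm y"
  shows "bilinear_norm X Y B \<le> K"
  unfolding bilinear_norm_def using assms
  by (intro SUP_unit_ball_le dual_norm_least) auto

lemma bilinear_norm_nonneg:
  assumes "subspace X" "subspace Y" "bounded_bilinear B"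
  shows "0 \<le> bilinear_norm X Y B"
proof -
  interpret bounded_bilinear B by fact
  obtain K where K: "0 \<le> K" "\<And>x y. norm (B x y) \<le> norm x * norm y * K"
    using nonneg_bounded by blast
  have "dual_norm Y (B x) \<le> K" if "norm x \<le> 1" for x
  proof -
    have "dual_norm Y (B x) \<le> K * norm x"
      using K assms(2) by (intro dual_norm_least) (auto simp: mult_ac)
    also have "\<dots> \<le> K" using that K(1) by (simp add: mult_left_le)
    finally show ?thesis .
  qed
  then have "bdd_above ((\<lambda>x. dual_norm Y (B x)) ` {x\<in>X. norm x \<le> 1})"
    by (auto intro!: bdd_aboveI2)
  then have "dual_norm Y (B 0) \<le> bilinear_norm X Y B"
    unfolding bilinear_norm_def using subspace_0[OF assms(1)] by (intro cSUP_upper) auto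
  then show ?thesis
    using dual_norm_nonneg[OF assms(2) bounded_linear_right[of 0]] by linarith
qed

section \<open>Trilinear forms\<close>

lemma bounded_trilinear_form_bound:
  assumes "bounded_trilinear_form T"
  obtains K where "0 \<le> K" "\<And>x y z. \<bar>T x y z\<bar> \<le> K * norm x * norm y * norm z"
proof -
  obtain K where K: "\<And>x y z. \<bar>T x y z\<bar> \<le> K * norm x * norm y * norm z"
    using assms unfolding bounded_trilinear_form_def by blast
  have "\<bar>T x y z\<bar> \<le> \<bar>K\<bar> * norm x * norm y * norm z" for x y z
    by (rule order_trans[OF K]) (intro mult_right_mono, auto)
  then show ?thesis using that[of "\<bar>K\<bar>"] by auto
qed

lemma bounded_bilinear_trilinear:
  assumes "bounded_trilinear_form T"
  shows "bounded_bilinear (T x)" "bounded_bilinear (\<lambda>x. T x y)"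
proof -
  have lin: "linear (\<lambda>x. T x y z)" "linear (\<lambda>y. T x y z)" "linear (T x y)" for x y z
    using assms unfolding bounded_trilinear_form_def by auto
  obtain K where K: "0 \<le> K" "\<And>x y z. \<bar>T x y z\<bar> \<le> K * norm x * norm y * norm z"
    using bounded_trilinear_form_bound[OF assms] by blast
  show "bounded_bilinear (T x)"
  proof
    have "norm (T x y z) \<le> norm y * norm z * (K * norm x)" for y z
      using K(2)[of x y z] by (simp add: mult_ac)
    then show "\<exists>C. \<forall>y z. norm (T x y z) \<le> norm y * norm z * C" by blast
  qed (simp_all only: linear_add[OF lin(2)] linear_add[OF lin(3)]
        linear_scale[OF lin(2)] linear_scale[OF lin(3)])
  show "bounded_bilinear (\<lambda>x. T x y)"
  proof
    have "norm (T x y z) \<le> norm x * norm z * (K * norm y)" for x z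
      using K(2)[of x y z] by (simp add: mult_ac)
    then show "\<exists>C. \<forall>x z. norm (T x y z) \<le> norm x * norm z * C" by blast
  qed (simp_all only: linear_add[OF lin(1)] linear_add[OF lin(3)]
        linear_scale[OF lin(1)] linear_scale[OF lin(3)])
qed

text \<open>The scheme of \<open>dual_norm_le_bilinear_norm\<close> one level up, with
  \<open>bilinear_norm Y Z (T x)\<close> as the sublinear function of \<open>x\<close>.\<close>

lemma abs_le_trilinear_norm:
  assumes "subspace X" "subspace Y" "subspace Z" "bounded_trilinear_form T"
    and "x \<in> X" "y \<in> Y" "z \<in> Z"
  shows "\<bar>T x y z\<bar> \<le> trilinear_norm X Y Z T * norm x * norm y * norm z"
proof -
  obtain K where K: "0 \<le> K" "\<And>x y z. \<bar>T x y z\<bar> \<le> K * norm x * norm y * norm z"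
    using bounded_trilinear_form_bound[OF assms(4)] by blast
  have bil: "bounded_bilinear (T x)" for x
    using bounded_bilinear_trilinear(1)[OF assms(4)] .
  have lin: "linear (\<lambda>x. T x y z)" for y z
    using assms(4) unfolding bounded_trilinear_form_def by auto
  have "bilinear_norm Y Z (T (c *\<^sub>R x)) \<le> \<bar>c\<bar> * bilinear_norm Y Z (T x)" for c x
  proof (rule bilinear_norm_least)
    show "\<bar>T (c *\<^sub>R x) y z\<bar> \<le> \<bar>c\<bar> * bilinear_norm Y Z (T x) * norm y * norm z"
      if "y \<in> Y" "z \<in> Z" for y z
      using abs_le_bilinear_norm[OF assms(2,3) bil[of x] that]
      by (simp add: linear_scale[OF lin] abs_mult mult_left_mono mult.assoc)
  qed (use assms bil in \<open>auto intro!: mult_nonneg_nonneg bilinear_norm_nonneg\<close>)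
  moreover have "bilinear_norm Y Z (T x) \<le> K * norm x" for x
    using K assms by (intro bilinear_norm_least) auto
  ultimately have "bilinear_norm Y Z (T x) \<le> trilinear_norm X Y Z T * norm x"
    unfolding trilinear_norm_def using assms by (intro sublinear_le_SUP_unit_ball[where K=K]) auto
  then have "bilinear_norm Y Z (T x) * norm y * norm z
      \<le> trilinear_norm X Y Z T * norm x * norm y * norm z"
    by (intro mult_right_mono) auto
  then show ?thesis
    using abs_le_bilinear_norm[OF assms(2,3) bil[of x] assms(6,7)] by linarith
qed

section \<open>The inf-sup condition\<close>

text \<open>\<open>inf_sup_const\<close> uses unit spheres and signed values. A nonzero
  \<open>y0\<close> makes the sphere of \<open>Y\<close> nonempty, and its symmetry makes the inner
  suprema nonnegative, so the infimum has a lower bound and can be compared with its value at the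
  normalised \<open>x\<close>.\<close>

lemma inf_sup_const_le_dual_norm:
  assumes "subspace X" "subspace Y" "bounded_bilinear B" "x \<in> X"
    and "y0 \<in> Y" "y0 \<noteq> 0"
  shows "inf_sup_const X Y B * norm x \<le> dual_norm Y (B x)"
proof -
  interpret bounded_bilinear B by fact
  let ?S = "{y\<in>Y. norm y = 1}"
  let ?s = "\<lambda>x. SUP y\<in>?S. B x y"
  have lin: "bounded_linear (B x)" for x by (rule bounded_linear_right)
  have le: "B x y \<le> dual_norm Y (B x)" if "y \<in> ?S" for x y
    using abs_le_dual_norm[OF assms(2) lin[of x], of y] that by auto
  have bdd: "bdd_above (B x ` ?S)" for x
    using le by (auto intro!: bdd_aboveI2)
  let ?y = "y0 /\<^sub>R norm y0"
  have y: "?y \<in> ?S" "- ?y \<in> ?S"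
    using assms by (auto simp: subspace_scale subspace_neg)
  \<comment> \<open>The supremum dominates both \<open>B x ?y\<close> and its negative.\<close>
  have nonneg: "0 \<le> ?s x" for x
    using cSUP_upper[OF y(1) bdd[of x]] cSUP_upper[OF y(2) bdd[of x]]
    unfolding minus_right by linarith
  show ?thesis
  proof (cases "x = 0")
    case True
    then show ?thesis using dual_norm_nonneg[OF assms(2) lin] by simp
  next
    case False
    let ?x = "x /\<^sub>R norm x"
    have "inf_sup_const X Y B \<le> ?s ?x"
      unfolding inf_sup_const_def using False nonneg assms
      by (intro cINF_lower bdd_belowI2[where m=0]) (auto simp: subspace_scale)
    also have "\<dots> \<le> dual_norm Y (B x) / norm x"
    proof (rule cSUP_least)
      show "B ?x y \<le> dual_norm Y (B x) / norm x" if "y \<in> ?S" for y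
        using le[OF that, of x] False by (simp add: scaleR_left divide_simps)
    qed (use y in blast)
    finally show ?thesis using False by (simp add: field_simps)
  qed
qed

section \<open>The residual and its derivative\<close>

lemma bounded_bilinear_DN:
  assumes "bounded_bilinear a" "bounded_trilinear_form G"
  shows "bounded_bilinear (DN a G u)"
proof -
  interpret a: bounded_bilinear a by fact
  interpret G1: bounded_bilinear "G u" using assms(2) by (rule bounded_bilinear_trilinear)
  interpret G2: bounded_bilinear "\<lambda>x. G x u" using assms(2) by (rule bounded_bilinear_trilinear)
  obtain K1 K2 K3 where K:
    "\<And>x y. norm (a x y) \<le> norm x * norm y * K1"
    "\<And>x y. norm (G u x y) \<le> norm x * norm y * K2"
    "\<And>x y. norm (G x u y) \<le> norm x * norm y * K3"
    using a.bounded G1.bounded G2.bounded by blast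
  show ?thesis
  proof
    have "norm (DN a G u x y) \<le> norm x * norm y * (K1 + K2 + K3)" for x y
      using K(1)[of x y] K(2)[of x y] K(3)[of x y] by (simp add: DN_def algebra_simps)
    then show "\<exists>K. \<forall>x y. norm (DN a G u x y) \<le> norm x * norm y * K" by blast
  qed (simp_all add: DN_def a.add_left a.add_right G1.add_left G1.add_right G2.add_left G2.add_right
      a.scaleR_left a.scaleR_right G1.scaleR_left G1.scaleR_right G2.scaleR_left G2.scaleR_right
      algebra_simps)
qed

lemma bounded_linear_Nhat:
  assumes "bounded_bilinear a" "bounded_trilinear_form G" "bounded_linear F"
  shows "bounded_linear (Nhat a G F x)"
proof -
  have "bounded_linear (a x)" "bounded_linear (G x x)"
    using assms bounded_bilinear_trilinear by (blast intro: bounded_bilinear.bounded_linear_right)+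
  then show ?thesis
    unfolding Nhat_def using assms(3) by (intro bounded_linear_add bounded_linear_sub)
qed

text \<open>Taylor's formula at \<open>u\<close>, exact because \<open>Nhat\<close> is quadratic. As
  \<open>G\<close> need not be symmetric, the two mixed terms stay separate in
  \<open>DN\<close>.\<close>

lemma Nhat_expansion:
  assumes "bounded_bilinear a" "bounded_trilinear_form G"
  shows "Nhat a G F w y = Nhat a G F u y - DN a G u (u - w) y + G (u - w) (u - w) y"
proof -
  interpret a: bounded_bilinear a by fact
  interpret G1: bounded_bilinear "G x" for x using assms(2) by (rule bounded_bilinear_trilinear)
  interpret G2: bounded_bilinear "\<lambda>x. G x y" for y using assms(2) by (rule bounded_bilinear_trilinear)
  show ?thesis
    unfolding Nhat_def DN_def
    by (simp only: a.diff_left G1.diff_left G2.diff_left)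
qed

text \<open>\<open>F\<close> cancels, and the quadratic part telescopes through the mixed term
  \<open>G v w y\<close>.\<close>

lemma Nhat_diff:
  assumes "bounded_bilinear a" "bounded_trilinear_form G"
  shows "Nhat a G F w y - Nhat a G F v y = a (w - v) y + G (w - v) w y + G v (w - v) y"
proof -
  interpret a: bounded_bilinear a by fact
  interpret G1: bounded_bilinear "G x" for x using assms(2) by (rule bounded_bilinear_trilinear)
  interpret G2: bounded_bilinear "\<lambda>x. G x y" for y using assms(2) by (rule bounded_bilinear_trilinear)
  show ?thesis
    unfolding Nhat_def
    by (simp only: a.diff_left G1.diff_left G2.diff_left)
qed

text \<open>Turns a pointwise perturbation bound into one between dual norms; \<open>K\<close> is
  the size of the perturbation.\<close>

lemma dual_norm_le_add:
  assumes "subspace Y" "bounded_linear g" "0 \<le> K"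
    and "\<And>y. y \<in> Y \<Longrightarrow> \<bar>f y\<bar> \<le> \<bar>g y\<bar> + K * norm y"
  shows "dual_norm Y f \<le> dual_norm Y g + K"
proof (rule dual_norm_least)
  show "\<bar>f y\<bar> \<le> (dual_norm Y g + K) * norm y" if "y \<in> Y" for y
    using assms(4)[OF that] abs_le_dual_norm[OF assms(1,2) that] by (simp add: algebra_simps)
qed (use assms in \<open>auto intro!: add_nonneg_nonneg dual_norm_nonneg\<close>)

text \<open>Lipschitz continuity on the ball of radius \<open>R\<close>: each of the two telescoped
  terms contributes one factor \<open>R\<close>. The norms are those of the ambient forms, so the
  bound also covers points outside \<open>X\<close>.\<close>

lemma abs_Nhat_diff_le:
  assumes "bounded_bilinear a" "bounded_trilinear_form G"
    and "0 \<le> trilinear_norm UNIV UNIV UNIV G" "norm w \<le> R" "norm v \<le> R"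
  shows "\<bar>Nhat a G F w y - Nhat a G F v y\<bar>
    \<le> (bilinear_norm UNIV UNIV a + 2 * trilinear_norm UNIV UNIV UNIV G * R) * norm (w - v) * norm y"
proof -
  let ?A = "bilinear_norm UNIV UNIV a" and ?T = "trilinear_norm UNIV UNIV UNIV G"
  let ?d = "norm (w - v)"
  have 1: "\<bar>a (w - v) y\<bar> \<le> ?A * ?d * norm y"
    using abs_le_bilinear_norm[OF _ _ assms(1)] by simp
  have "\<bar>G (w - v) w y\<bar> \<le> ?T * ?d * norm w * norm y"
    using abs_le_trilinear_norm[OF _ _ _ assms(2)] by simp
  also have "\<dots> \<le> ?T * ?d * R * norm y"
    using assms by (intro mult_right_mono mult_left_mono) auto
  finally have 2: "\<bar>G (w - v) w y\<bar> \<le> ?T * ?d * R * norm y" .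
  have "\<bar>G v (w - v) y\<bar> \<le> ?T * norm v * ?d * norm y"
    using abs_le_trilinear_norm[OF _ _ _ assms(2)] by simp
  also have "\<dots> \<le> ?T * R * ?d * norm y"
    using assms by (intro mult_right_mono mult_left_mono) auto
  finally have 3: "\<bar>G v (w - v) y\<bar> \<le> ?T * R * ?d * norm y" .
  show ?thesis
    unfolding Nhat_diff[OF assms(1,2)] using 1 2 3 by (simp add: algebra_simps)
qed

section \<open>Reliability and efficiency\<close>

theorem corollary3p5:
  fixes X Xh :: "'a::banach set"
    and Y :: "'b::banach set"
    and a :: "'a \<Rightarrow> 'b \<Rightarrow> real"
    and \<Gamma> :: "'a \<Rightarrow> 'a \<Rightarrow> 'b \<Rightarrow> real"
    and F :: "'b \<Rightarrow> real"
    and Q :: "'a \<Rightarrow> 'a"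
    and u v\<^sub>h :: 'a
    and \<Lambda>\<^sub>4 \<beta> \<gamma> \<kappa> \<epsilon> L Crel1 Crel2 Ceff1 :: real
  assumes "subspace X" "complete X"
    and "subspace Xh" "complete Xh"
    and "subspace Y" "complete Y"
    and "bounded_bilinear a"
    and "bounded_trilinear_form \<Gamma>"
    and "trilinear_norm UNIV UNIV UNIV \<Gamma> > 0"
    and "bounded_linear F"
    and "\<exists>x\<in>X. \<exists>x'\<in>X. \<exists>y\<in>Y. \<Gamma> x x' y \<noteq> 0"
    and "\<gamma> = trilinear_norm X X Y \<Gamma>"
    and "bounded_linear_on Xh Q" "Q ` Xh \<subseteq> X"
    and "\<Lambda>\<^sub>4 \<ge> 0"
    and "\<forall>x\<in>Xh. norm (x - Q x) \<le> \<Lambda>\<^sub>4 * infdist x X"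
    and "regular_solution X Y a \<Gamma> F u"
    and "\<beta> = inf_sup_const X Y (DN a \<Gamma> u)"
    and "v\<^sub>h \<in> Xh"
    and "norm (u - Q v\<^sub>h) < \<beta> / \<gamma>"
    and "0 < \<kappa>" "\<kappa> < 1"
    and "norm (u - v\<^sub>h) \<le> \<epsilon>"
    and "\<epsilon> \<le> \<kappa> * \<beta> / (\<gamma> * (1 + \<Lambda>\<^sub>4))"
    and "L = bilinear_norm UNIV UNIV a
             + 2 * trilinear_norm UNIV UNIV UNIV \<Gamma> * (norm u + \<epsilon> * (1 + \<Lambda>\<^sub>4))"
    and "Crel1 = 1 / (\<beta> * (1 - \<kappa>))"
    and "Crel2 = 1 + L * Crel1"
    and "Ceff1 = (1 + \<Lambda>\<^sub>4) * (bilinear_norm X Y (DN a \<Gamma> u) + \<beta>) + L * \<Lambda>\<^sub>4"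
  shows "norm (u - v\<^sub>h) \<le> Crel1 * dual_norm Y (Nhat a \<Gamma> F v\<^sub>h) + Crel2 * norm (Q v\<^sub>h - v\<^sub>h)
       \<and> norm (Q v\<^sub>h - v\<^sub>h) \<le> \<Lambda>\<^sub>4 * norm (u - v\<^sub>h)
       \<and> dual_norm Y (Nhat a \<Gamma> F v\<^sub>h) \<le> Ceff1 * norm (u - v\<^sub>h)"
proof -
  let ?N = "Nhat a \<Gamma> F" and ?D = "DN a \<Gamma> u" and ?w = "Q v\<^sub>h"
  let ?e = "norm (u - ?w)" and ?d = "norm (?w - v\<^sub>h)" and ?\<delta> = "norm (u - v\<^sub>h)"
  note X = assms(1) and Y = assms(5) and a = assms(7) and G = assms(8)
  have Nu: "?N u y = 0" if "y \<in> Y" for y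
    using assms(17) that unfolding regular_solution_def by auto
  have uX: "u \<in> X" using assms(17) unfolding regular_solution_def by auto
  have eX: "u - ?w \<in> X"
    using uX X assms(14,19) by (auto intro: subspace_diff)
  have D: "bounded_bilinear ?D" using a G by (rule bounded_bilinear_DN)
  have blD: "bounded_linear (?D x)" for x by (rule bounded_bilinear.bounded_linear_right[OF D])
  have blN: "bounded_linear (?N x)" for x
    using a G assms(10) by (rule bounded_linear_Nhat)
  \<comment> \<open>A point where \<open>\<Gamma>\<close> does not vanish supplies both the nonzero
    \<open>y0\<close> for the inf-sup lemma and the positivity of \<open>\<gamma>\<close>.\<close>
  obtain x x' y0 where nz: "x \<in> X" "x' \<in> X" "y0 \<in> Y" "\<Gamma> x x' y0 \<noteq> 0"
    using assms(11) by blast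
  have y0: "y0 \<noteq> 0"
    using nz(4) bounded_bilinear.zero_right[OF bounded_bilinear_trilinear(1)[OF G]] by auto
  have G_le: "\<bar>\<Gamma> x x' y\<bar> \<le> \<gamma> * norm x * norm x' * norm y" if "x \<in> X" "x' \<in> X" "y \<in> Y" for x x' y
    using abs_le_trilinear_norm[OF X X Y G that] assms(12) by simp
  have "0 < \<gamma> * (norm x * norm x' * norm y0)"
    using G_le[OF nz(1-3)] nz(4) by (simp add: mult.assoc)
  then have \<gamma>: "0 < \<gamma>"
    by (meson linorder_not_le mult_nonneg_nonneg norm_ge_zero mult_nonpos_nonneg)
  \<comment> \<open>\<open>\<beta> / \<gamma>\<close> strictly exceeds a norm, so it is
    positive.\<close>
  have \<beta>: "0 < \<beta>"
    using le_less_trans[OF norm_ge_zero assms(20)] \<gamma> by (simp add: zero_less_divide_iff)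
  have "?d \<le> \<Lambda>\<^sub>4 * infdist v\<^sub>h X"
    using assms(16,19) by (simp add: norm_minus_commute)
  \<comment> \<open>\<open>u\<close> is itself a candidate in the distance to
    \<open>X\<close>.\<close>
  also have "\<dots> \<le> \<Lambda>\<^sub>4 * ?\<delta>"
    using infdist_le[OF uX, of v\<^sub>h] assms(15)
    by (intro mult_left_mono) (auto simp: dist_norm norm_minus_commute)
  finally have d: "?d \<le> \<Lambda>\<^sub>4 * ?\<delta>" .
  have \<delta>ed: "?\<delta> \<le> ?e + ?d" using norm_triangle_ineq[of "u - ?w" "?w - v\<^sub>h"] by simp
  have "?e \<le> ?\<delta> + ?d"
    using norm_triangle_ineq4[of "u - v\<^sub>h" "?w - v\<^sub>h"] by simp
  then have e\<delta>: "?e \<le> (1 + \<Lambda>\<^sub>4) * ?\<delta>" using d by (simp add: algebra_simps)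
  also have "\<dots> \<le> (1 + \<Lambda>\<^sub>4) * \<epsilon>"
    using assms(15,23) by (intro mult_left_mono) auto
  finally have e\<epsilon>: "?e \<le> \<epsilon> * (1 + \<Lambda>\<^sub>4)" by (simp add: mult.commute)
  \<comment> \<open>The factor \<open>1 + \<Lambda>\<^sub>4\<close> in the smallness condition pays
    for passing from \<open>?\<delta>\<close> to \<open>?e\<close>.\<close>
  have "\<epsilon> * (1 + \<Lambda>\<^sub>4) * \<gamma> \<le> \<kappa> * \<beta>"
    using assms(15,24) \<gamma> by (simp add: pos_le_divide_eq mult_ac)
  then have \<gamma>e: "\<gamma> * ?e \<le> \<kappa> * \<beta>"
    using order_trans[OF mult_right_mono[OF e\<epsilon>, of \<gamma>]] \<gamma> by (simp add: mult.commute)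
  have \<gamma>ee: "\<gamma> * ?e * ?e \<le> \<kappa> * \<beta> * ?e" using \<gamma>e by (intro mult_right_mono) auto
  have \<epsilon>: "0 \<le> \<epsilon>" using assms(23) norm_ge_zero order_trans by blast

  \<comment> \<open>This radius covers both \<open>?w\<close> and \<open>v\<^sub>h\<close>, and
    turns the Lipschitz constant into \<open>L\<close>.\<close>
  let ?R = "norm u + \<epsilon> * (1 + \<Lambda>\<^sub>4)"
  have wR: "norm ?w \<le> ?R"
    using norm_triangle_ineq4[of u "u - ?w"] e\<epsilon> by simp
  have "\<epsilon> \<le> \<epsilon> * (1 + \<Lambda>\<^sub>4)" using \<epsilon> assms(15) by (simp add: algebra_simps)
  then have vR: "norm v\<^sub>h \<le> ?R"
    using norm_triangle_ineq4[of u "u - v\<^sub>h"] assms(23) by simp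
  have lip: "\<bar>?N ?w y - ?N v\<^sub>h y\<bar> \<le> L * ?d * norm y" for y
    unfolding assms(25) using assms(9) by (intro abs_Nhat_diff_le a G wR vR) auto
  have L: "0 \<le> L"
    unfolding assms(25) using assms(9) \<epsilon> assms(15) bilinear_norm_nonneg[OF _ _ a]
    by (intro add_nonneg_nonneg mult_nonneg_nonneg) auto
  have Nw: "dual_norm Y (?N ?w) \<le> dual_norm Y (?N v\<^sub>h) + L * ?d"
  proof (rule dual_norm_le_add[OF Y blN])
    show "\<bar>?N ?w y\<bar> \<le> \<bar>?N v\<^sub>h y\<bar> + L * ?d * norm y" for y
      using lip[of y] by linarith
  qed (use L in simp)
  have Nv: "dual_norm Y (?N v\<^sub>h) \<le> dual_norm Y (?N ?w) + L * ?d"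
  proof (rule dual_norm_le_add[OF Y blN])
    show "\<bar>?N v\<^sub>h y\<bar> \<le> \<bar>?N ?w y\<bar> + L * ?d * norm y" for y
      using lip[of y] by linarith
  qed (use L in simp)

  have exp: "?N ?w y = - ?D (u - ?w) y + \<Gamma> (u - ?w) (u - ?w) y" if "y \<in> Y" for y
    using Nhat_expansion[OF a G, of F ?w y u] Nu[OF that] by simp
  \<comment> \<open>Since \<open>u - ?w\<close> lies in \<open>X\<close>, the restricted norm
    \<open>\<gamma>\<close> applies here, and one factor \<open>?e\<close> is traded for
    \<open>\<kappa> * \<beta>\<close>.\<close>
  have Gee: "\<bar>\<Gamma> (u - ?w) (u - ?w) y\<bar> \<le> \<kappa> * \<beta> * ?e * norm y" if "y \<in> Y" for y
    using G_le[OF eX eX that] mult_right_mono[OF \<gamma>ee, of "norm y"] by simp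
  have \<kappa>\<beta>e: "0 \<le> \<kappa> * \<beta> * ?e" using assms(21) \<beta> by simp
  \<comment> \<open>The expansion is read in both directions: \<open>De\<close> serves reliability,
    \<open>Ne\<close> efficiency.\<close>
  have De: "dual_norm Y (?D (u - ?w)) \<le> dual_norm Y (?N ?w) + \<kappa> * \<beta> * ?e"
  proof (rule dual_norm_le_add[OF Y blN \<kappa>\<beta>e])
    show "\<bar>?D (u - ?w) y\<bar> \<le> \<bar>?N ?w y\<bar> + \<kappa> * \<beta> * ?e * norm y" if "y \<in> Y" for y
      using exp[OF that] Gee[OF that] by linarith
  qed
  have Ne: "dual_norm Y (?N ?w) \<le> dual_norm Y (?D (u - ?w)) + \<kappa> * \<beta> * ?e"
  proof (rule dual_norm_le_add[OF Y blD \<kappa>\<beta>e])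
    show "\<bar>?N ?w y\<bar> \<le> \<bar>?D (u - ?w) y\<bar> + \<kappa> * \<beta> * ?e * norm y" if "y \<in> Y" for y
      using exp[OF that] Gee[OF that] by linarith
  qed

  have "\<beta> * ?e \<le> dual_norm Y (?D (u - ?w))"
    unfolding assms(18) by (rule inf_sup_const_le_dual_norm[OF X Y D eX nz(3) y0])
  \<comment> \<open>The quadratic contribution \<open>\<kappa> * \<beta> * ?e\<close> is absorbed on
    the left; the remaining factor is the reciprocal of \<open>Crel1\<close>.\<close>
  then have "\<beta> * (1 - \<kappa>) * ?e \<le> dual_norm Y (?N v\<^sub>h) + L * ?d"
    using De Nw by (simp add: algebra_simps)
  then have "?e \<le> Crel1 * (dual_norm Y (?N v\<^sub>h) + L * ?d)"
    unfolding assms(26) using \<beta> assms(22) by (simp add: pos_le_divide_eq mult_ac)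
  \<comment> \<open>The summand 1 in \<open>Crel2\<close> comes from the triangle inequality through
    \<open>?w\<close>.\<close>
  then have rel: "?\<delta> \<le> Crel1 * dual_norm Y (?N v\<^sub>h) + Crel2 * ?d"
    unfolding assms(27) using \<delta>ed by (simp add: algebra_simps)

  let ?M = "bilinear_norm X Y ?D"
  \<comment> \<open>Estimating \<open>\<kappa>\<close> by 1 produces the summand
    \<open>\<beta>\<close> in \<open>Ceff1\<close>.\<close>
  have "\<kappa> * \<beta> * ?e \<le> \<beta> * ?e" using assms(22) \<beta> by (intro mult_right_mono) auto
  then have "dual_norm Y (?N ?w) \<le> (?M + \<beta>) * ?e"
    using Ne dual_norm_le_bilinear_norm[OF X Y D eX] by (simp add: algebra_simps)
  also have "\<dots> \<le> (?M + \<beta>) * ((1 + \<Lambda>\<^sub>4) * ?\<delta>)"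
    using e\<delta> \<beta> bilinear_norm_nonneg[OF X Y D] by (intro mult_left_mono) auto
  finally have "dual_norm Y (?N ?w) \<le> (1 + \<Lambda>\<^sub>4) * (?M + \<beta>) * ?\<delta>" by (simp add: mult_ac)
  moreover have "L * ?d \<le> L * \<Lambda>\<^sub>4 * ?\<delta>" using mult_left_mono[OF d L] by (simp add: mult.assoc)
  ultimately have "dual_norm Y (?N v\<^sub>h) \<le> Ceff1 * ?\<delta>"
    unfolding assms(28) using Nv by (simp only: distrib_right)
  with rel d show ?thesis by blast
qed

end
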